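(* Let $n>3$ and $2\le m\le n-1$ be integers, let $a\in\mathbb{C}$, and let $A$ be the $n\times n$ companion matrix with spectrum (counted with algebraic multiplicity) $$\sigma(A)=\{\underbrace{0,\ldots,0}_{n-m},\ \underbrace{a,\ldots,a}_{m}\},$$ that is, the companion matrix of $p(z)=z^{n-m}(z-a)^m$. If the numerical range $W(A)$ is a circular disk, then $a=0$.
   Context: For an $n\times n$ complex matrix $A$, the numerical range is $W(A)=\{\langle Ax,x\rangle : x\in\mathbb{C}^n,\ \|x\|=1\}\subset\mathbb{C}$. The companion matrix of a monic polynomial $p(z)=z^n+a_1z^{n-1}+\cdots+a_{n-1}z+a_n$ is the $n\times n$ matrix with entries $1$ on the first superdiagonal, last row $(-a_n,-a_{n-1},\ldots,-a_2,-a_1)$, and all other entries $0$; its characteristic polynomial is $p(z)$. A circular disk is a closed disk $\{z\in\mathbb{C}:|z-c|\le\lambda\}$ with $c\in\mathbb{C}$ and radius $\lambda>0$. *)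

theory Defs
  imports
    "HOL-Analysis.L2_Norm"
    "Jordan_Normal_Form.Char_Poly"
begin

text \<open>
  Columns are indexed from 0, so for \<open>p = z^n + a_1 z^(n-1) + \<dots> + a_n\<close> the last row
  \<open>(-a_n, \<dots>, -a_1)\<close> has \<open>- coeff p j\<close> in column \<open>j\<close>. Intended for monic \<open>p\<close> of positive degree.
\<close>

definition companion_matrix :: "'a :: comm_ring_1 poly \<Rightarrow> 'a mat" where
  "companion_matrix p =
     mat (degree p) (degree p)
       (\<lambda>(i, j). if i = degree p - 1 then - coeff p j else if j = i + 1 then 1 else 0)"

definition numerical_range :: "complex mat \<Rightarrow> complex set" where
  "numerical_range A =
     {(A *\<^sub>v x) \<bullet>c x | x.
        x \<in> carrier_vec (dim_row A) \<and> L2_set (\<lambda>i. cmod (x $ i)) {..<dim_vec x} = 1}"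

text \<open>The radius is required to be positive: a single point is not a circular disk.\<close>

definition is_circular_disk :: "complex set \<Rightarrow> bool" where
  "is_circular_disk S \<longleftrightarrow> (\<exists>c r. r > 0 \<and> S = {z. cmod (z - c) \<le> r})"

lemma companion_matrix_carrier:
  "companion_matrix p \<in> carrier_mat (degree p) (degree p)"
  by (simp add: companion_matrix_def)

lemma det_companion_shift:
  fixes c :: "nat \<Rightarrow> 'a :: comm_ring_1" and x :: 'a
  shows "det (mat (Suc n) (Suc n) (\<lambda>(i, j).
            (if i = j then x else 0)
            + (if i = n then c j else if j = i + 1 then - 1 else 0)))
         = x ^ Suc n + (\<Sum>j\<le>n. c j * x ^ j)"
proof (induction n arbitrary: c)
  case 0
  show ?case by (subst det_single) auto
next
  case (Suc n)
  define M where "M = mat (Suc (Suc n)) (Suc (Suc n)) (\<lambda>(i, j).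
            (if i = j then x else 0)
            + (if i = Suc n then c j else if j = i + 1 then - 1 else 0))"
  have M: "M \<in> carrier_mat (Suc (Suc n)) (Suc (Suc n))" by (simp add: M_def)
  have del0: "mat_delete M 0 0 = mat (Suc n) (Suc n) (\<lambda>(i, j).
            (if i = j then x else 0)
            + (if i = n then c (Suc j) else if j = i + 1 then - 1 else 0))"
    by (rule eq_matI) (auto simp: mat_delete_def M_def)
  have c0: "cofactor M 0 0 = x ^ Suc n + (\<Sum>j\<le>n. c (Suc j) * x ^ j)"
    unfolding cofactor_def del0 using Suc.IH[of "\<lambda>j. c (Suc j)"] by simp
  have tri: "det (mat_delete M (Suc n) 0) = prod_list (diag_mat (mat_delete M (Suc n) 0))"
    by (rule det_lower_triangular[of "Suc n"]) (auto simp: mat_delete_def M_def)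
  have "diag_mat (mat_delete M (Suc n) 0) = replicate (Suc n) (- 1)"
    by (rule nth_equalityI) (auto simp: diag_mat_def mat_delete_def M_def simp del: upt_Suc replicate_Suc)
  then have c1: "cofactor M (Suc n) 0 = 1"
    unfolding cofactor_def tri by (simp add: power_mult_distrib[symmetric] prod_list_replicate)
  have "det M = (\<Sum>i<Suc (Suc n). M $$ (i, 0) * cofactor M i 0)"
    by (rule laplace_expansion_column[OF M]) simp
  also have "\<dots> = (\<Sum>i\<in>{0, Suc n}. M $$ (i, 0) * cofactor M i 0)"
    by (rule sum.mono_neutral_right) (auto simp: M_def)
  also have "\<dots> = x * cofactor M 0 0 + c 0"
    by (simp add: c1) (simp add: M_def)
  also have "\<dots> = x ^ Suc (Suc n) + (\<Sum>j\<le>Suc n. c j * x ^ j)"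
    by (subst sum.atMost_Suc_shift) (simp add: c0 algebra_simps sum_distrib_left)
  finally show ?case by (simp add: M_def)
qed

lemma char_poly_companion_matrix:
  assumes "monic p" and "degree p > 0"
  shows "char_poly (companion_matrix p) = p"
proof -
  obtain n where n: "degree p = Suc n" using assms(2) by (cases "degree p") auto
  have "char_poly_matrix (companion_matrix p) = mat (Suc n) (Suc n) (\<lambda>(i, j).
            (if i = j then [:0, 1:] else 0)
            + (if i = n then [:coeff p j:] else if j = i + 1 then - 1 else 0))"
    by (rule eq_matI) (auto simp: char_poly_matrix_def companion_matrix_def n one_pCons)
  then have "char_poly (companion_matrix p)
      = [:0, 1:] ^ Suc n + (\<Sum>j\<le>n. [:coeff p j:] * [:0, 1:] ^ j)"
    unfolding char_poly_def
    using det_companion_shift[where x = "[:0, 1:]" and c = "\<lambda>j. [:coeff p j:]" and n = n] by simp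
  also have "\<dots> = (\<Sum>j\<le>degree p. monom (coeff p j) j)"
    using assms(1) by (simp add: n monom_altdef add.commute)
  also have "\<dots> = p" by (rule poly_as_sum_of_monoms)
  finally show ?thesis .
qed

end

theory Submission
  imports Defs
begin

text \<open>
  Let \<open>W(A)\<close> be the disk with center \<open>c\<close> and radius \<open>r > 0\<close>, and \<open>B = A - c\<close>. For \<open>|w| = 1\<close> the
  Hermitian matrix \<open>2 r - cnj w B - w B\<^sup>*\<close> is positive semidefinite and singular, because
  the disk is attained in every direction. So \<open>det (2 r w - B - w\<^sup>2 B\<^sup>*)\<close>, a polynomial in \<open>w\<close>,
  vanishes on the unit circle and hence identically. The contradiction to \<open>a \<noteq> 0\<close> comes from
  the behaviour at \<open>w = 0\<close>, off the circle (\<open>disk_boundary_kernel\<close>,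
  \<open>singular_on_circle_imp_det_zero\<close>).

  At order zero, \<open>B\<close> is singular, so \<open>c\<close> is a root of \<open>p\<close>: either \<open>a\<close> or \<open>0\<close>
  (\<open>disk_center_is_root\<close>).

  Let \<open>c = a \<noteq> 0\<close>, a root of multiplicity \<open>m \<ge> 2\<close>. A polynomial kernel vector
  \<open>u0 + u1 w + u2 w\<^sup>2 + \<dots>\<close> is a perturbed Jordan chain: \<open>B u0 = 0\<close>, \<open>B u1 = 2 r u0\<close>,
  \<open>B u2 + B\<^sup>* u0 = 2 r u1\<close>. Pairing the last equation with the left eigenvector, whose entries are
  the coefficients of \<open>q = p / (z - a)\<close>, gives \<open>4 r\<^sup>2 s(a) = - a^(n - 1) <q, p>\<close> with \<open>s = q / (z - a)\<close>
  and the inner product of the coefficient sequences (\<open>double_root_identity\<close>).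
  The inner product is a nonzero multiple of \<open>cnj a\<close>, as the signs of the coefficients
  alternate (\<open>double_root_sum\<close>). For \<open>m \<ge> 3\<close> this contradicts \<open>s(a) = 0\<close>. For \<open>m = 2\<close> it yields
  \<open>4 r\<^sup>2 = (1 + |a|\<^sup>2)\<^sup>2 - 1\<close>, whereas the last \<open>2 \<times> 2\<close> block alone forces \<open>2 r \<ge> 1 + |a|\<^sup>2\<close>
  (\<open>radius_lower_bound_last_block\<close>).

  Let \<open>c = 0\<close>. After conjugation with the diagonal matrix of the powers of \<open>w\<close>, the parameter occurs
  only in the last row and the last column. Rescaling the last row by \<open>w^m\<close> and letting \<open>w = 0\<close> leaves
  a singular matrix whose kernel consists of Chebyshev values \<open>U_i(r)\<close> with \<open>U_(n - m)(r) = 0\<close>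
  (\<open>limit_kernel_vector\<close>). But \<open>W(A)\<close> contains the numerical range of the nilpotent Jordan
  block of size \<open>n - 1\<close>, and this prevents \<open>r\<close> from being a zero of \<open>U_k\<close> for \<open>k \<le> n - 2\<close>
  (\<open>chebyshev_U_nonzero\<close>).
\<close>

section \<open>Matrices singular along the unit circle\<close>

lemma det_zero_iff_kernel:
  fixes A :: "'a :: idom mat"
  assumes A: "A \<in> carrier_mat n n"
  shows "det A = 0 \<longleftrightarrow> (\<exists>v. (\<exists>i<n. v i \<noteq> 0) \<and> (\<forall>i<n. (\<Sum>j<n. A $$ (i, j) * v j) = 0))"
    (is "_ \<longleftrightarrow> ?R")
proof -
  have mult: "(A *\<^sub>v v) $ i = (\<Sum>j<n. A $$ (i, j) * v $ j)" if "v \<in> carrier_vec n" "i < n" for v i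
    using A that by (simp add: scalar_prod_def atLeast0LessThan)
  show ?thesis
    unfolding det_0_iff_vec_prod_zero[OF A]
  proof
    assume "\<exists>v. v \<in> carrier_vec n \<and> v \<noteq> 0\<^sub>v n \<and> A *\<^sub>v v = 0\<^sub>v n"
    then obtain v where v: "v \<in> carrier_vec n" "v \<noteq> 0\<^sub>v n" "A *\<^sub>v v = 0\<^sub>v n" by blast
    have "\<exists>i<n. v $ i \<noteq> 0"
      using v(1,2) by (metis carrier_vecD eq_vecI index_zero_vec(1) index_zero_vec(2))
    moreover have "\<forall>i<n. (\<Sum>j<n. A $$ (i, j) * v $ j) = 0"
      using mult[OF v(1)] v(3) by (metis index_zero_vec(1))
    ultimately show ?R by (intro exI[of _ "\<lambda>i. v $ i"]) blast
  next
    assume ?R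
    then obtain v where v: "\<exists>i<n. v i \<noteq> 0" "\<forall>i<n. (\<Sum>j<n. A $$ (i, j) * v j) = 0" by blast
    have "vec n v \<noteq> 0\<^sub>v n" using v(1) by (metis index_vec index_zero_vec(1))
    moreover have "A *\<^sub>v vec n v = 0\<^sub>v n"
      using A v(2) by (intro eq_vecI) (auto simp: scalar_prod_def atLeast0LessThan)
    ultimately show "\<exists>v. v \<in> carrier_vec n \<and> v \<noteq> 0\<^sub>v n \<and> A *\<^sub>v v = 0\<^sub>v n"
      by (intro exI[of _ "vec n v"]) auto
  qed
qed

lemma infinite_unit_circle: "infinite {w :: complex. cmod w = 1}"
proof -
  have "inj_on (\<lambda>t. Complex t (sqrt (1 - t\<^sup>2))) {0..1::real}"
    by (auto intro: inj_onI)
  then have "infinite ((\<lambda>t. Complex t (sqrt (1 - t\<^sup>2))) ` {0..1::real})"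
    by (simp add: finite_image_iff infinite_Icc)
  moreover have "(\<lambda>t. Complex t (sqrt (1 - t\<^sup>2))) ` {0..1::real} \<subseteq> {w. cmod w = 1}"
    by (auto simp: cmod_def power_le_one)
  ultimately show ?thesis using finite_subset by blast
qed

lemma poly_eval_det:
  "det (map_mat (\<lambda>p. poly p w) P) = poly (det P) w" for w :: complex
proof -
  have "comm_ring_hom (\<lambda>p::complex poly. poly p w)" by unfold_locales auto
  then show ?thesis by (rule comm_ring_hom.hom_det)
qed

text \<open>
  The determinant is a polynomial in the parameter, so vanishing on the infinite unit circle makes
  it the zero polynomial. This lets a condition on rotations \<open>w\<close> with \<open>|w| = 1\<close> be used at
  \<open>w = 0\<close>, either formally (a polynomial kernel vector) or by plain evaluation.
\<close>

lemma singular_on_circle_imp_det_zero: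
  fixes P :: "complex poly mat"
  assumes P: "P \<in> carrier_mat n n"
    and sing: "\<And>w. cmod w = 1 \<Longrightarrow>
      \<exists>x. (\<exists>i<n. x i \<noteq> 0) \<and> (\<forall>i<n. (\<Sum>j<n. poly (P $$ (i, j)) w * x j) = 0)"
  shows "det P = 0"
proof (rule ccontr)
  assume "det P \<noteq> 0"
  then have "finite {w. poly (det P) w = 0}" by (rule poly_roots_finite)
  moreover have "{w. cmod w = 1} \<subseteq> {w. poly (det P) w = 0}"
  proof clarify
    fix w :: complex
    assume "cmod w = 1"
    have "det (map_mat (\<lambda>p. poly p w) P) = 0"
      using P sing[OF \<open>cmod w = 1\<close>] by (subst det_zero_iff_kernel[of _ n]) auto
    then show "poly (det P) w = 0" unfolding poly_eval_det .
  qed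
  ultimately show False using infinite_unit_circle finite_subset by blast
qed

lemma singular_on_circle_imp_singular_everywhere:
  fixes P :: "complex poly mat"
  assumes P: "P \<in> carrier_mat n n"
    and sing: "\<And>w. cmod w = 1 \<Longrightarrow>
      \<exists>x. (\<exists>i<n. x i \<noteq> 0) \<and> (\<forall>i<n. (\<Sum>j<n. poly (P $$ (i, j)) w * x j) = 0)"
  shows "\<exists>x. (\<exists>i<n. x i \<noteq> 0) \<and> (\<forall>i<n. (\<Sum>j<n. poly (P $$ (i, j)) z * x j) = 0)"
proof -
  have "det P = 0" using P sing by (rule singular_on_circle_imp_det_zero)
  then have "det (map_mat (\<lambda>p. poly p z) P) = 0" by (simp only: poly_eval_det) simp
  then show ?thesis using P by (subst (asm) det_zero_iff_kernel[of _ n]) auto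
qed

section \<open>Sesquilinear forms and disks as numerical ranges\<close>

definition sesq_form :: "nat \<Rightarrow> (nat \<Rightarrow> nat \<Rightarrow> complex) \<Rightarrow> (nat \<Rightarrow> complex) \<Rightarrow> complex" where
  "sesq_form n B x = (\<Sum>i<n. (\<Sum>j<n. B i j * x j) * cnj (x i))"

text \<open>
  First-order optimality: with \<open>g = N x\<close>, the form at \<open>x - t g\<close> is
  \<open>- 2 t |g|^2 + O(t^2)\<close>, which is negative for small \<open>t > 0\<close> unless \<open>g = 0\<close>.
\<close>

lemma psd_form_zero_imp_kernel:
  assumes herm: "\<And>i j. i < n \<Longrightarrow> j < n \<Longrightarrow> N j i = cnj (N i j)"
    and psd: "\<And>y. 0 \<le> Re (sesq_form n N y)"
    and zero: "sesq_form n N x = 0"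
    and "i < n"
  shows "(\<Sum>j<n. N i j * x j) = 0"
proof -
  define g where "g i = (\<Sum>j<n. N i j * x j)" for i
  define G where "G = (\<Sum>i<n. (cmod (g i))\<^sup>2)"
  define F where "F = Re (sesq_form n N g)"
  have G0: "G \<ge> 0" and F0: "F \<ge> 0" using psd by (auto simp: G_def F_def sum_nonneg)
  have gg: "(\<Sum>i<n. g i * cnj (g i)) = of_real G"
    unfolding G_def of_real_sum complex_norm_square ..
  have xg: "(\<Sum>i<n. (\<Sum>j<n. N i j * g j) * cnj (x i)) = of_real G"
  proof -
    have "(\<Sum>i<n. (\<Sum>j<n. N i j * g j) * cnj (x i)) = (\<Sum>i<n. \<Sum>j<n. N i j * g j * cnj (x i))"
      by (simp add: sum_distrib_right)
    also have "\<dots> = (\<Sum>j<n. \<Sum>i<n. N i j * g j * cnj (x i))" by (rule sum.swap)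
    also have "\<dots> = (\<Sum>j<n. g j * cnj (g j))"
      by (intro sum.cong refl) (simp add: g_def sum_distrib_left mult_ac flip: herm)
    finally show ?thesis using gg by simp
  qed
  have quad: "0 \<le> - 2 * t * G + t\<^sup>2 * F" for t :: real
  proof -
    have row: "(\<Sum>j<n. N i j * (x j - of_real t * g j)) = g i - of_real t * (\<Sum>j<n. N i j * g j)" for i
      by (simp add: g_def algebra_simps sum_subtractf sum_distrib_left)
    have xform: "sesq_form n N x = (\<Sum>i<n. g i * cnj (x i))" by (simp add: sesq_form_def g_def)
    have "sesq_form n N (\<lambda>i. x i - of_real t * g i)
        = sesq_form n N x - of_real t * (\<Sum>i<n. g i * cnj (g i))
          - of_real t * (\<Sum>i<n. (\<Sum>j<n. N i j * g j) * cnj (x i)) + (of_real t)\<^sup>2 * sesq_form n N g"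
      unfolding xform unfolding sesq_form_def row
      by (simp add: algebra_simps sum.distrib sum_subtractf sum_distrib_left power2_eq_square)
    also have "\<dots> = - 2 * t * G + (of_real t)\<^sup>2 * sesq_form n N g"
      by (simp add: zero gg xg)
    finally show ?thesis using psd[of "\<lambda>i. x i - of_real t * g i"]
      by (simp add: F_def flip: of_real_power)
  qed
  have "G = 0"
  proof (rule ccontr)
    assume "G \<noteq> 0"
    then have "G > 0" using G0 by simp
    \<comment> \<open>With \<open>G = t (F + 1)\<close> the quadratic equals \<open>- t^2 (F + 2)\<close>.\<close>
    define t where "t = G / (F + 1)"
    have t: "t > 0" "G = t * (F + 1)" using \<open>G > 0\<close> F0 by (auto simp: t_def)
    have "0 \<le> - 2 * t * G + t\<^sup>2 * F" by (rule quad)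
    also have "\<dots> = t\<^sup>2 * (- (F + 2))"
      by (subst t(2)) (simp add: algebra_simps power2_eq_square)
    also have "\<dots> < 0" using t(1) F0 by (intro mult_pos_neg) auto
    finally show False by simp
  qed
  then have "\<forall>i<n. g i = 0" by (simp add: G_def sum_nonneg_eq_0_iff)
  then show ?thesis using \<open>i < n\<close> by (simp add: g_def)
qed

lemma numerical_range_eq_sesq_form:
  assumes A: "A \<in> carrier_mat n n"
  shows "numerical_range A =
    {sesq_form n (\<lambda>i j. A $$ (i, j)) x | x. (\<Sum>i<n. (cmod (x i))\<^sup>2) = 1}"
proof -
  have form: "(A *\<^sub>v v) \<bullet>c v = sesq_form n (\<lambda>i j. A $$ (i, j)) (\<lambda>i. v $ i)"
    if "v \<in> carrier_vec n" for v
    using A that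
    by (auto simp: sesq_form_def scalar_prod_def atLeast0LessThan conjugate_complex_def intro!: sum.cong)
  have norm: "L2_set (\<lambda>i. cmod (v $ i)) {..<dim_vec v} = 1 \<longleftrightarrow> (\<Sum>i<n. (cmod (v $ i))\<^sup>2) = 1"
    if "v \<in> carrier_vec n" for v :: "complex vec"
    using that by (simp add: L2_set_def)
  show ?thesis
  proof (intro equalityI subsetI)
    fix z assume "z \<in> numerical_range A"
    then obtain v where "v \<in> carrier_vec n" "z = (A *\<^sub>v v) \<bullet>c v"
      "L2_set (\<lambda>i. cmod (v $ i)) {..<dim_vec v} = 1"
      using A unfolding numerical_range_def by auto
    then show "z \<in> {sesq_form n (\<lambda>i j. A $$ (i, j)) x | x. (\<Sum>i<n. (cmod (x i))\<^sup>2) = 1}"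
      using form norm by (intro CollectI exI[of _ "\<lambda>i. v $ i"]) simp
  next
    fix z assume "z \<in> {sesq_form n (\<lambda>i j. A $$ (i, j)) x | x. (\<Sum>i<n. (cmod (x i))\<^sup>2) = 1}"
    then obtain x where x: "z = sesq_form n (\<lambda>i j. A $$ (i, j)) x" "(\<Sum>i<n. (cmod (x i))\<^sup>2) = 1"
      by blast
    have "z = (A *\<^sub>v vec n x) \<bullet>c vec n x"
      using form[of "vec n x"] x(1) by (simp add: sesq_form_def)
    moreover have "L2_set (\<lambda>i. cmod (vec n x $ i)) {..<dim_vec (vec n x)} = 1"
      using norm[of "vec n x"] x(2) by simp
    ultimately show "z \<in> numerical_range A"
      using A unfolding numerical_range_def by (intro CollectI exI[of _ "vec n x"]) simp
  qed
qed

lemma sesq_form_scalar: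
  "sesq_form n (\<lambda>i j. if i = j then c else 0) x = c * of_real (\<Sum>i<n. (cmod (x i))\<^sup>2)"
proof -
  have "sesq_form n (\<lambda>i j. if i = j then c else 0) x = (\<Sum>i<n. c * (x i * cnj (x i)))"
    unfolding sesq_form_def by (intro sum.cong refl) (simp add: if_distrib[where f="\<lambda>u. u * _"] sum.delta cong: if_cong)
  also have "\<dots> = c * of_real (\<Sum>i<n. (cmod (x i))\<^sup>2)"
    unfolding of_real_sum complex_norm_square sum_distrib_left ..
  finally show ?thesis .
qed

lemma sesq_form_diff:
  "sesq_form n (\<lambda>i j. B i j - C i j) x = sesq_form n B x - sesq_form n C x"
  by (simp add: sesq_form_def algebra_simps sum_subtractf)

lemma sesq_form_cmult:
  "sesq_form n (\<lambda>i j. k * B i j) x = k * sesq_form n B x"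
  by (simp add: sesq_form_def sum_distrib_left mult_ac)

lemma sesq_form_adjoint:
  "sesq_form n (\<lambda>i j. cnj (B j i)) x = cnj (sesq_form n B x)"
proof -
  have "sesq_form n (\<lambda>i j. cnj (B j i)) x = (\<Sum>i<n. \<Sum>j<n. cnj (B j i) * x j * cnj (x i))"
    by (simp add: sesq_form_def sum_distrib_right)
  also have "\<dots> = (\<Sum>j<n. \<Sum>i<n. cnj (B j i) * x j * cnj (x i))" by (rule sum.swap)
  also have "\<dots> = cnj (sesq_form n B x)"
    by (simp add: sesq_form_def sum_distrib_right sum_distrib_left mult_ac)
  finally show ?thesis .
qed

lemma sesq_form_vec_cmult:
  "sesq_form n B (\<lambda>i. k * x i) = k * cnj k * sesq_form n B x"
  by (simp add: sesq_form_def sum_distrib_left mult_ac)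

lemma disk_form_bound:
  assumes A: "A \<in> carrier_mat n n"
    and W: "numerical_range A = {z. cmod (z - c) \<le> r}"
  shows "cmod (sesq_form n (\<lambda>i j. A $$ (i, j) - (if i = j then c else 0)) x)
    \<le> r * (\<Sum>i<n. (cmod (x i))\<^sup>2)"
proof -
  define R where "R = (\<Sum>i<n. (cmod (x i))\<^sup>2)"
  let ?q = "sesq_form n (\<lambda>i j. A $$ (i, j) - (if i = j then c else 0))"
  show ?thesis
  proof (cases "R = 0")
    case True
    then have "\<forall>i<n. x i = 0" by (simp add: R_def sum_nonneg_eq_0_iff)
    then have "?q x = 0" by (simp add: sesq_form_def)
    then show ?thesis using True by (simp add: R_def)
  next
    case False
    moreover have "R \<ge> 0" by (simp add: R_def sum_nonneg)
    ultimately have R: "R > 0" by simp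
    define k where "k = complex_of_real (1 / sqrt R)"
    define y where "y i = k * x i" for i
    have k2: "k * cnj k = of_real (1 / R)" using R by (simp add: k_def flip: of_real_mult)
    have "(cmod k)\<^sup>2 = 1 / R" using R by (simp add: k_def norm_divide power_divide)
    then have "(\<Sum>i<n. (cmod (y i))\<^sup>2) = 1"
      using R by (simp add: y_def norm_mult power_mult_distrib flip: sum_divide_distrib R_def)
    then have "sesq_form n (\<lambda>i j. A $$ (i, j)) y \<in> numerical_range A"
      and "?q y = sesq_form n (\<lambda>i j. A $$ (i, j)) y - c"
      using numerical_range_eq_sesq_form[OF A] by (auto simp: sesq_form_diff sesq_form_scalar)
    then have "cmod (?q y) \<le> r" using W by simp
    moreover have "?q y = of_real (1 / R) * ?q x" unfolding y_def sesq_form_vec_cmult k2 ..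
    ultimately show ?thesis using R by (simp add: norm_divide field_simps flip: R_def)
  qed
qed

text \<open>
  Every boundary point \<open>c + r w\<close> of the disk belongs to the numerical range, and at a vector
  attaining it the positive semidefinite form of \<open>2 r - cnj w (A - c) - w (A - c)\<^sup>*\<close> vanishes.
  Multiplying this Hermitian matrix by \<open>w\<close> makes its entries polynomial in \<open>w\<close>.
\<close>

lemma disk_boundary_kernel:
  fixes c w :: complex
  assumes A: "A \<in> carrier_mat n n"
    and W: "numerical_range A = {z. cmod (z - c) \<le> r}" and "r > 0"
    and w: "cmod w = 1"
    and B: "B = (\<lambda>i j. A $$ (i, j) - (if i = j then c else 0))"
  shows "\<exists>x. (\<exists>i<n. x i \<noteq> 0) \<and>
    (\<forall>i<n. (\<Sum>j<n. ((if i = j then 2 * of_real r * w else 0) - B i j - w\<^sup>2 * cnj (B j i)) * x j) = 0)"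
proof -
  have ww: "w * cnj w = 1" using w by (simp add: complex_norm_square[symmetric])
  define N where "N i j = (if i = j then 2 * complex_of_real r else 0)
    - (cnj w * B i j - (- w) * cnj (B j i))" for i j
  have formN: "sesq_form n N y
      = of_real (2 * (r * (\<Sum>i<n. (cmod (y i))\<^sup>2) - Re (cnj w * sesq_form n B y)))" for y
  proof -
    have "cnj w * sesq_form n B y + w * cnj (sesq_form n B y) = of_real (2 * Re (cnj w * sesq_form n B y))"
      using complex_add_cnj[of "cnj w * sesq_form n B y"] by simp
    then show ?thesis
      unfolding N_def sesq_form_diff sesq_form_cmult sesq_form_scalar sesq_form_adjoint
      by (simp add: algebra_simps)
  qed
  have bound: "Re (cnj w * sesq_form n B y) \<le> r * (\<Sum>i<n. (cmod (y i))\<^sup>2)" for y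
  proof -
    have "Re (cnj w * sesq_form n B y) \<le> cmod (cnj w * sesq_form n B y)" by (rule complex_Re_le_cmod)
    also have "\<dots> \<le> r * (\<Sum>i<n. (cmod (y i))\<^sup>2)"
      using disk_form_bound[OF A W, of y] w by (simp add: norm_mult B)
    finally show ?thesis .
  qed
  have "c + of_real r * w \<in> numerical_range A"
    using W w \<open>r > 0\<close> by (simp add: norm_mult)
  then obtain x where x: "sesq_form n (\<lambda>i j. A $$ (i, j)) x = c + of_real r * w"
    "(\<Sum>i<n. (cmod (x i))\<^sup>2) = 1"
    using numerical_range_eq_sesq_form[OF A] by auto
  have Bx: "sesq_form n B x = of_real r * w"
    unfolding B sesq_form_diff sesq_form_scalar x by simp
  have "cnj w * sesq_form n B x = of_real r" using Bx ww by (simp add: mult_ac)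
  then have "sesq_form n N x = 0" using formN[of x] x(2) by simp
  moreover have "0 \<le> Re (sesq_form n N y)" for y
    unfolding formN Re_complex_of_real using bound[of y] by simp
  ultimately have ker: "(\<Sum>j<n. N i j * x j) = 0" if "i < n" for i
    using that by (intro psd_form_zero_imp_kernel[of n N]) (auto simp: N_def)
  have "\<exists>i<n. x i \<noteq> 0"
  proof (rule ccontr)
    assume "\<not> (\<exists>i<n. x i \<noteq> 0)"
    then have "(\<Sum>i<n. (cmod (x i))\<^sup>2) = 0" by simp
    then show False using x(2) by simp
  qed
  moreover have "(\<Sum>j<n. ((if i = j then 2 * of_real r * w else 0) - B i j - w\<^sup>2 * cnj (B j i)) * x j) = 0"
    if "i < n" for i
  proof -
    have "w * N i j = (if i = j then 2 * of_real r * w else 0)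
        - (w * cnj w) * B i j - w\<^sup>2 * cnj (B j i)" for j
      by (simp add: N_def algebra_simps power2_eq_square)
    then have "(if i = j then 2 * of_real r * w else 0) - B i j - w\<^sup>2 * cnj (B j i) = w * N i j" for j
      by (simp add: ww)
    then show ?thesis using ker[OF that] by (simp add: mult.assoc flip: sum_distrib_left)
  qed
  ultimately show ?thesis by blast
qed

lemma coeff_quadratic_mult:
  "coeff ([:a, b, c:] * q) d =
    a * coeff q d + (if d \<ge> 1 then b * coeff q (d - 1) else 0)
      + (if d \<ge> 2 then c * coeff q (d - 2) else 0)"
  for q :: "'a :: comm_ring_1 poly"
  by (cases d; cases "d - 1") (auto simp: coeff_pCons split: nat.splits)

text \<open>
  The matrix \<open>2 r X - B - X^2 B\<^sup>*\<close> over the polynomial ring is singular, hence has a nonzero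
  polynomial kernel vector; \<open>u0\<close>, \<open>u1\<close>, \<open>u2\<close> are its three lowest coefficient vectors, and the three
  equations are the three lowest coefficients of the kernel relation.
\<close>

lemma disk_kernel_expansion:
  fixes c :: complex
  assumes A: "A \<in> carrier_mat n n"
    and W: "numerical_range A = {z. cmod (z - c) \<le> r}" and "r > 0"
    and B: "B = (\<lambda>i j. A $$ (i, j) - (if i = j then c else 0))"
  obtains u0 u1 u2 where
    "\<exists>i<n. u0 i \<noteq> 0"
    "\<forall>i<n. (\<Sum>j<n. B i j * u0 j) = 0"
    "\<forall>i<n. (\<Sum>j<n. B i j * u1 j) = 2 * of_real r * u0 i"
    "\<forall>i<n. (\<Sum>j<n. B i j * u2 j) + (\<Sum>j<n. cnj (B j i) * u0 j) = 2 * of_real r * u1 i"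
proof -
  define P where "P = mat n n (\<lambda>(i, j). [:- B i j, if i = j then 2 * complex_of_real r else 0, - cnj (B j i):])"
  have P: "P \<in> carrier_mat n n" by (simp add: P_def)
  have "det P = 0"
  proof (rule singular_on_circle_imp_det_zero[OF P])
    fix w :: complex assume w: "cmod w = 1"
    have "poly (P $$ (i, j)) w = (if i = j then 2 * of_real r * w else 0) - B i j - w\<^sup>2 * cnj (B j i)"
      if "i < n" "j < n" for i j
      using that by (simp add: P_def algebra_simps power2_eq_square)
    then show "\<exists>x. (\<exists>i<n. x i \<noteq> 0) \<and> (\<forall>i<n. (\<Sum>j<n. poly (P $$ (i, j)) w * x j) = 0)"
      using disk_boundary_kernel[OF A W \<open>r > 0\<close> w B] by simp
  qed
  then obtain v where v: "\<exists>i<n. v i \<noteq> 0" "\<forall>i<n. (\<Sum>j<n. P $$ (i, j) * v j) = 0"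
    using det_zero_iff_kernel[OF P] by blast
  \<comment> \<open>The kernel vector may be divisible by \<open>X\<close>: counting starts at its order \<open>k\<close>.\<close>
  define k where "k = (LEAST k. \<exists>i<n. coeff (v i) k \<noteq> 0)"
  have "\<exists>k. \<exists>i<n. coeff (v i) k \<noteq> 0" using v(1) by (metis leading_coeff_0_iff)
  then have k: "\<exists>i<n. coeff (v i) k \<noteq> 0" unfolding k_def by (rule LeastI_ex)
  have below: "coeff (v i) d = 0" if "i < n" "d < k" for i d
    using that not_less_Least k_def by blast
  have row: "(\<Sum>j<n. B i j * coeff (v j) d) + (if d \<ge> 2 then \<Sum>j<n. cnj (B j i) * coeff (v j) (d - 2) else 0)
      = (if d \<ge> 1 then 2 * of_real r * coeff (v i) (d - 1) else 0)" if "i < n" for i d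
  proof -
    have "0 = (\<Sum>j<n. coeff (P $$ (i, j) * v j) d)"
      using v(2) that by (simp flip: coeff_sum)
    also have "\<dots> = (\<Sum>j<n. - (B i j * coeff (v j) d)
        + (if d \<ge> 1 then (if i = j then 2 * of_real r * coeff (v j) (d - 1) else 0) else 0)
        - (if d \<ge> 2 then cnj (B j i) * coeff (v j) (d - 2) else 0))"
      using that by (intro sum.cong refl) (simp add: P_def coeff_quadratic_mult del: mult_pCons_left)
    also have "\<dots> = - (\<Sum>j<n. B i j * coeff (v j) d)
        + (if d \<ge> 1 then 2 * of_real r * coeff (v i) (d - 1) else 0)
        - (if d \<ge> 2 then \<Sum>j<n. cnj (B j i) * coeff (v j) (d - 2) else 0)"
      using that by (simp add: sum.distrib sum_subtractf sum_negf)
    finally show ?thesis by (simp add: algebra_simps)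
  qed
  show ?thesis
  proof
    show "\<exists>i<n. coeff (v i) k \<noteq> 0" by (rule k)
    show "\<forall>i<n. (\<Sum>j<n. B i j * coeff (v j) k) = 0"
    proof (intro allI impI)
      show "(\<Sum>j<n. B i j * coeff (v j) k) = 0" if "i < n" for i
        using row[OF that, of k] that by (simp add: below split: if_splits)
    qed
    show "\<forall>i<n. (\<Sum>j<n. B i j * coeff (v j) (k + 1)) = 2 * of_real r * coeff (v i) k"
    proof (intro allI impI)
      show "(\<Sum>j<n. B i j * coeff (v j) (k + 1)) = 2 * of_real r * coeff (v i) k" if "i < n" for i
        using row[OF that, of "k + 1"] that by (simp add: below split: if_splits)
    qed
    show "\<forall>i<n. (\<Sum>j<n. B i j * coeff (v j) (k + 2)) + (\<Sum>j<n. cnj (B j i) * coeff (v j) k)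
        = 2 * of_real r * coeff (v i) (k + 1)"
    proof (intro allI impI)
      show "(\<Sum>j<n. B i j * coeff (v j) (k + 2)) + (\<Sum>j<n. cnj (B j i) * coeff (v j) k)
          = 2 * of_real r * coeff (v i) (k + 1)" if "i < n" for i
        using row[OF that, of "k + 2"] by simp
    qed
  qed
qed

section \<open>Companion matrices\<close>

lemma companion_row:
  assumes "n > 0" "degree p = n" "i < n"
  shows "(\<Sum>j<n. (companion_matrix p $$ (i, j) - (if i = j then c else 0)) * x j)
    = (if i = n - 1 then - (\<Sum>j<n. coeff p j * x j) else x (i + 1)) - c * x i"
proof -
  have "(\<Sum>j<n. (companion_matrix p $$ (i, j) - (if i = j then c else 0)) * x j)
      = (\<Sum>j<n. companion_matrix p $$ (i, j) * x j) - (\<Sum>j<n. if i = j then c * x j else 0)"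
    unfolding sum_subtractf[symmetric] by (intro sum.cong refl) (simp add: algebra_simps)
  also have "(\<Sum>j<n. if i = j then c * x j else 0) = c * x i" using assms by simp
  also have "(\<Sum>j<n. companion_matrix p $$ (i, j) * x j)
      = (\<Sum>j<n. if i = n - 1 then - (coeff p j * x j) else if j = i + 1 then x j else 0)"
    using assms by (intro sum.cong refl) (simp add: companion_matrix_def)
  also have "\<dots> = (if i = n - 1 then - (\<Sum>j<n. coeff p j * x j) else x (i + 1))"
    using assms by (auto simp: sum_negf)
  finally show ?thesis .
qed

lemma companion_column:
  assumes "n > 0" "degree p = n" "j < n"
  shows "(\<Sum>i<n. y i * (companion_matrix p $$ (i, j) - (if i = j then c else 0)))
    = (case j of 0 \<Rightarrow> 0 | Suc i \<Rightarrow> y i) - y (n - 1) * coeff p j - c * y j"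
proof -
  obtain N where n: "n = Suc N" using \<open>n > 0\<close> by (cases n) auto
  have "(\<Sum>i<n. y i * (companion_matrix p $$ (i, j) - (if i = j then c else 0)))
      = (\<Sum>i<n. y i * companion_matrix p $$ (i, j)) - (\<Sum>i<n. if i = j then c * y i else 0)"
    unfolding sum_subtractf[symmetric] by (intro sum.cong refl) (simp add: algebra_simps)
  also have "(\<Sum>i<n. if i = j then c * y i else 0) = c * y j" using assms by simp
  also have "(\<Sum>i<n. y i * companion_matrix p $$ (i, j))
      = (\<Sum>i<N. if j = i + 1 then y i else 0) - y N * coeff p j"
  proof -
    have "(\<Sum>i<N. y i * companion_matrix p $$ (i, j)) = (\<Sum>i<N. if j = i + 1 then y i else 0)"
      using assms by (intro sum.cong refl) (simp add: n companion_matrix_def)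
    then show ?thesis using assms by (simp add: n companion_matrix_def)
  qed
  also have "(\<Sum>i<N. if j = i + 1 then y i else 0) = (case j of 0 \<Rightarrow> 0 | Suc i \<Rightarrow> y i)"
    using assms by (cases j) (auto simp: n)
  finally show ?thesis by (simp add: n algebra_simps)
qed

text \<open>
  A polynomial, read as a row vector of coefficients, is multiplied by \<open>z - c\<close> modulo \<open>p\<close> when
  \<open>A - c\<close> acts from the right. So \<open>p / (z - c)\<close> is a left eigenvector for a root \<open>c\<close>, and
  \<open>p / (z - c)^2\<close> the next vector of a left Jordan chain when \<open>c\<close> is a double root.
\<close>

lemma companion_left_mult:
  fixes p q :: "complex poly"
  assumes "n > 0" "degree p = n" "j < n"
  shows "(\<Sum>i<n. coeff q i * (companion_matrix p $$ (i, j) - (if i = j then c else 0)))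
    = coeff ([:- c, 1:] * q) j - coeff q (n - 1) * coeff p j"
  unfolding companion_column[OF assms] by (simp add: coeff_pCons split: nat.splits)

lemma poly_eq_sum_lessThan:
  fixes q :: "'a :: comm_semiring_1 poly"
  assumes "degree q < n"
  shows "poly q x = (\<Sum>i<n. coeff q i * x ^ i)"
  unfolding poly_altdef using assms
  by (intro sum.mono_neutral_left) (auto simp: coeff_eq_0)

text \<open>
  The rows of shift type force a kernel vector to be geometric; the last row then evaluates \<open>p\<close>.
\<close>

lemma companion_eigenvector:
  assumes "n > 0" "degree p = n" "monic p"
    and ker: "\<And>i. i < n \<Longrightarrow>
      (\<Sum>j<n. (companion_matrix p $$ (i, j) - (if i = j then c else 0)) * u j) = 0"
  shows "i < n \<Longrightarrow> u i = c ^ i * u 0" and "poly p c * u 0 = 0"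
proof -
  have u: "u i = c ^ i * u 0" if "i < n" for i
    using that
  proof (induction i)
    case (Suc i)
    moreover have "i \<noteq> n - 1" using Suc.prems by simp
    ultimately show ?case using ker[of i] companion_row[of n p i c u] assms by simp
  qed simp
  show "i < n \<Longrightarrow> u i = c ^ i * u 0" by (rule u)
  obtain N where n: "n = Suc N" using \<open>n > 0\<close> by (cases n) auto
  have "0 = - (\<Sum>j<n. coeff p j * u j) - c * u N"
    using ker[of N] companion_row[of n p N c u] assms by (simp add: n)
  also have "(\<Sum>j<n. coeff p j * u j) = (\<Sum>j<n. coeff p j * c ^ j) * u 0"
    unfolding sum_distrib_right
  proof (intro sum.cong refl)
    fix j assume "j \<in> {..<n}"
    then show "coeff p j * u j = coeff p j * c ^ j * u 0" using u[of j] by simp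
  qed
  also have "c * u N = coeff p n * c ^ n * u 0" using u[of N] assms by (simp add: n)
  finally have "(\<Sum>j<Suc n. coeff p j * c ^ j) * u 0 = 0" by (simp add: algebra_simps) 
  then show "poly p c * u 0 = 0" using assms by (simp add: poly_altdef lessThan_Suc_atMost)
qed

text \<open>
  The expansion of the kernel at \<open>w = 0\<close> starts with an eigenvector for the eigenvalue \<open>c\<close>.
\<close>

lemma disk_center_is_root:
  fixes p :: "complex poly"
  assumes "n > 0" and p: "degree p = n" "monic p"
    and W: "numerical_range (companion_matrix p) = {z. cmod (z - c) \<le> r}" and "r > 0"
  shows "poly p c = 0"
proof -
  define B where "B = (\<lambda>i j. companion_matrix p $$ (i, j) - (if i = j then c else 0))"
  have A: "companion_matrix p \<in> carrier_mat n n" using companion_matrix_carrier[of p] p by simp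
  obtain u u1 u2 where nz: "\<exists>i<n. u i \<noteq> 0"
    and u: "\<forall>i<n. (\<Sum>j<n. B i j * u j) = 0"
    and "\<forall>i<n. (\<Sum>j<n. B i j * u1 j) = 2 * of_real r * u i"
    and "\<forall>i<n. (\<Sum>j<n. B i j * u2 j) + (\<Sum>j<n. cnj (B j i) * u j) = 2 * of_real r * u1 i"
    using disk_kernel_expansion[OF A W \<open>r > 0\<close> B_def] by blast
  note eigen = companion_eigenvector[OF \<open>n > 0\<close> p u[rule_format, unfolded B_def]]
  have "u 0 \<noteq> 0" using nz eigen(1) by (metis mult_zero_right)
  then show ?thesis using eigen(2) by simp
qed

section \<open>Disks centered at a nonzero multiple root\<close>

text \<open>
  The solvability condition of the perturbation problem at second order. The left eigenvector \<open>q\<close>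
  annihilates \<open>B u2\<close>, so \<open>q \<cdot> B\<^sup>* u0 = 2 r q \<cdot> u1\<close>; and \<open>q = s B\<close> turns the right-hand side into
  \<open>4 r^2 s \<cdot> u0 = 4 r^2 s(c)\<close>, with \<open>u0\<close> scaled to the vector of powers of \<open>c\<close>. On the left the
  shift and the scalar part of \<open>B\<^sup>*\<close> contribute multiples of \<open>q(c) = 0\<close>
  and of \<open>(q(c) - q(0)) / c = 0\<close>, and only the last row of the companion matrix survives.
\<close>

lemma double_root_identity:
  fixes p q s :: "complex poly" and r :: real
  assumes n: "n > 1" and p: "degree p = n" "monic p" "p = [:- c, 1:] * q"
    and q: "q = [:- c, 1:] * s" and "coeff q 0 = 0" and "c \<noteq> 0"
    and W: "numerical_range (companion_matrix p) = {z. cmod (z - c) \<le> r}" and "r > 0"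
  shows "4 * (of_real r)\<^sup>2 * poly s c = - (c ^ (n - 1)) * (\<Sum>i<n. coeff q i * cnj (coeff p i))"
proof -
  define B where "B = (\<lambda>i j. companion_matrix p $$ (i, j) - (if i = j then c else 0))"
  have A: "companion_matrix p \<in> carrier_mat n n" using companion_matrix_carrier[of p] p(1) by simp
  obtain N where N: "n = Suc N" using n by (cases n) auto
  have q0: "q \<noteq> 0" "s \<noteq> 0" using p q by auto
  have dq: "degree q = N" using p(1) q0 unfolding p(3) N by (subst (asm) degree_mult_eq) auto
  have ds: "Suc (degree s) = N" using dq q0 unfolding q by (subst (asm) degree_mult_eq) auto
  have lq: "coeff q N = 1" using p(2) dq unfolding p(3) lead_coeff_mult by simp
  obtain u0 u1 u2 where nz: "\<exists>i<n. u0 i \<noteq> 0"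
    and u0: "\<forall>i<n. (\<Sum>j<n. B i j * u0 j) = 0"
    and u1: "\<forall>i<n. (\<Sum>j<n. B i j * u1 j) = 2 * of_real r * u0 i"
    and u2: "\<forall>i<n. (\<Sum>j<n. B i j * u2 j) + (\<Sum>j<n. cnj (B j i) * u0 j) = 2 * of_real r * u1 i"
    using disk_kernel_expansion[OF A W \<open>r > 0\<close> B_def] by blast
  have u0_eq: "u0 i = c ^ i * u0 0" if "i < n" for i
    using companion_eigenvector(1)[of n p c u0 i] u0 that p(1,2) n by (auto simp: B_def)
  have u00: "u0 0 \<noteq> 0" using nz u0_eq by (metis mult_zero_right)
  have left: "(\<Sum>i<n. f i * (\<Sum>j<n. B i j * x j)) = (\<Sum>j<n. (\<Sum>i<n. f i * B i j) * x j)" for f x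
    unfolding sum_distrib_left sum_distrib_right
    by (subst sum.swap) (simp add: mult.assoc)
  have qB: "(\<Sum>i<n. coeff q i * B i j) = 0" if "j < n" for j
    using companion_left_mult[where n=n and p=p and j=j and c=c and q=q, folded p(3)] that dq lq p(1) n by (simp add: B_def N)
  have sB: "(\<Sum>i<n. coeff s i * B i j) = coeff q j" if "j < n" for j
    using companion_left_mult[where n=n and p=p and j=j and c=c and q=s, folded q] that ds p(1) n
    by (simp add: B_def N coeff_eq_0)
  have qu1: "(\<Sum>i<n. coeff q i * u1 i) = 2 * of_real r * poly s c * u0 0"
  proof -
    have "(\<Sum>i<n. coeff q i * u1 i) = (\<Sum>j<n. (\<Sum>i<n. coeff s i * B i j) * u1 j)" by (simp add: sB)
    also have "\<dots> = (\<Sum>i<n. coeff s i * (\<Sum>j<n. B i j * u1 j))" by (simp only: left)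
    also have "\<dots> = (\<Sum>i<n. 2 * of_real r * u0 0 * (coeff s i * c ^ i))"
    proof (intro sum.cong refl)
      fix i assume "i \<in> {..<n}"
      then show "coeff s i * (\<Sum>j<n. B i j * u1 j) = 2 * of_real r * u0 0 * (coeff s i * c ^ i)"
        using u0_eq[of i] u1 by simp
    qed
    also have "\<dots> = 2 * of_real r * u0 0 * (\<Sum>i<n. coeff s i * c ^ i)"
      by (simp only: sum_distrib_left)
    also have "\<dots> = 2 * of_real r * poly s c * u0 0"
      using poly_eq_sum_lessThan[of s n c] ds N by simp
    finally show ?thesis .
  qed
  have "(\<Sum>i<n. coeff q i * (\<Sum>j<n. cnj (B j i) * u0 j))
      = (\<Sum>i<n. coeff q i * (2 * of_real r * u1 i)) - (\<Sum>i<n. coeff q i * (\<Sum>j<n. B i j * u2 j))"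
    unfolding sum_subtractf[symmetric] right_diff_distrib[symmetric]
    by (intro sum.cong refl) (simp add: u2[rule_format, symmetric])
  also have "(\<Sum>i<n. coeff q i * (\<Sum>j<n. B i j * u2 j)) = 0" by (simp add: left qB)
  also have "(\<Sum>i<n. coeff q i * (2 * of_real r * u1 i)) = 2 * of_real r * (\<Sum>i<n. coeff q i * u1 i)"
    by (simp add: sum_distrib_left mult_ac)
  finally have one: "(\<Sum>i<n. coeff q i * (\<Sum>j<n. cnj (B j i) * u0 j)) = 4 * (of_real r)\<^sup>2 * poly s c * u0 0"
    by (simp add: qu1 power2_eq_square)
  have "(\<Sum>i<n. coeff q i * (\<Sum>j<n. cnj (B j i) * u0 j))
      = (\<Sum>j<n. u0 j * cnj (\<Sum>i<n. B j i * cnj (coeff q i)))"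
    unfolding cnj_sum sum_distrib_left
    by (subst sum.swap) (simp add: mult_ac)
  also have "\<dots> = (\<Sum>j<n. c ^ j * u0 0 * (coeff q (Suc j) - cnj c * coeff q j
      - (if j = N then \<Sum>i<n. coeff q i * cnj (coeff p i) else 0)))"
  proof (intro sum.cong refl)
    fix j assume "j \<in> {..<n}"
    then have "j < n" by simp
    have "coeff q (Suc j) = 0" if "j = N" using that dq by (simp add: coeff_eq_0)
    then show "u0 j * cnj (\<Sum>i<n. B j i * cnj (coeff q i)) = c ^ j * u0 0 * (coeff q (Suc j) - cnj c * coeff q j
      - (if j = N then \<Sum>i<n. coeff q i * cnj (coeff p i) else 0))"
      using companion_row[of n p j c "\<lambda>i. cnj (coeff q i)"] u0_eq[of j] \<open>j < n\<close> n p(1)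
      by (auto simp: B_def N mult.commute)
  qed
  also have "\<dots> = u0 0 * ((\<Sum>j<n. coeff q (Suc j) * c ^ j) - cnj c * (\<Sum>j<n. coeff q j * c ^ j)
      - c ^ N * (\<Sum>i<n. coeff q i * cnj (coeff p i)))"
    by (simp add: algebra_simps sum_distrib_left sum_subtractf sum.distrib N if_distrib cong: if_cong)
  also have "(\<Sum>j<n. coeff q j * c ^ j) = 0"
    using poly_eq_sum_lessThan[of q n c] dq q by (simp add: N)
  also have "(\<Sum>j<n. coeff q (Suc j) * c ^ j) = 0"
  proof -
    have "0 = (\<Sum>j<Suc n. coeff q j * c ^ j)"
      using poly_eq_sum_lessThan[of q "Suc n" c] dq q by (simp add: N)
    also have "\<dots> = c * (\<Sum>j<n. coeff q (Suc j) * c ^ j)"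
      using \<open>coeff q 0 = 0\<close> by (simp add: sum.lessThan_Suc_shift sum_distrib_left mult_ac del: sum.lessThan_Suc)
    finally show ?thesis using \<open>c \<noteq> 0\<close> by simp
  qed
  finally have "u0 0 * (4 * (of_real r)\<^sup>2 * poly s c)
      = u0 0 * (- (c ^ (n - 1)) * (\<Sum>i<n. coeff q i * cnj (coeff p i)))"
    using one by (simp add: N mult_ac del: sum.lessThan_Suc)
  then show ?thesis by (rule mult_left_cancel[OF u00, THEN iffD1])
qed

lemma coeff_linear_power_binomial:
  "coeff ([:b, 1:] ^ N) i = of_nat (N choose i) * b ^ (N - i)" for b :: "'a :: comm_ring_1"
proof (cases "i \<le> N")
  case True
  then show ?thesis by (subst coeff_linear_poly_power) auto
next
  case False
  have "degree ([:b, 1:] ^ N) \<le> N" using degree_power_le[of "[:b, 1:]" N] by simp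
  then show ?thesis using False by (simp add: coeff_eq_0 binomial_eq_0)
qed

lemma coeff_X_power_mult:
  "coeff ([:0, 1:] ^ k * q) i = (if k \<le> i then coeff q (i - k) else 0)" for q :: "'a :: comm_ring_1 poly"
  using coeff_monom_mult[of 1 k q i] by (simp add: monom_altdef)

text \<open>
  The coefficients of \<open>(z - a)^M\<close> alternate, so in the inner product with \<open>(z - a)^(M + 1)\<close>
  all terms are positive multiples of the same number \<open>- cnj a\<close>: nothing cancels.
\<close>

lemma double_root_sum:
  fixes a :: complex
  shows "(\<Sum>i<k + Suc M. coeff ([:0, 1:] ^ k * [:- a, 1:] ^ M) i
        * cnj (coeff ([:0, 1:] ^ k * [:- a, 1:] ^ Suc M) i))
    = - cnj a * of_real (\<Sum>i\<le>M. real (M choose i) * real (Suc M choose i) * (cmod a ^ 2) ^ (M - i))"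
proof -
  have "(\<Sum>i<k + Suc M. coeff ([:0, 1:] ^ k * [:- a, 1:] ^ M) i
        * cnj (coeff ([:0, 1:] ^ k * [:- a, 1:] ^ Suc M) i))
      = (\<Sum>i\<in>{k..<k + Suc M}. coeff ([:0, 1:] ^ k * [:- a, 1:] ^ M) i
        * cnj (coeff ([:0, 1:] ^ k * [:- a, 1:] ^ Suc M) i))"
    by (intro sum.mono_neutral_right) (auto simp: coeff_X_power_mult simp del: power_Suc split: if_splits)
  also have "\<dots> = (\<Sum>i\<in>{0..<Suc M}. coeff ([:- a, 1:] ^ M) i * cnj (coeff ([:- a, 1:] ^ Suc M) i))"
    by (rule sum.reindex_bij_witness[of _ "\<lambda>i. i + k" "\<lambda>i. i - k"])
      (auto simp only: coeff_X_power_mult, auto)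
  also have "\<dots> = (\<Sum>i\<in>{0..<Suc M}. - cnj a *
      of_real (real (M choose i) * real (Suc M choose i) * (cmod a ^ 2) ^ (M - i)))"
  proof (intro sum.cong refl)
    fix i assume "i \<in> {0..<Suc M}"
    then have i: "Suc M - i = Suc (M - i)" by auto
    have "(- a) ^ (M - i) * cnj ((- a) ^ (M - i)) = of_real ((cmod a ^ 2) ^ (M - i))"
      unfolding complex_cnj_power power_mult_distrib[symmetric] of_real_power complex_norm_square[symmetric]
      by (simp add: complex_norm_square[symmetric])
    then have "(- a) ^ (M - i) * cnj ((- a) ^ Suc (M - i)) = - cnj a * of_real ((cmod a ^ 2) ^ (M - i))"
      by (simp add: mult_ac)
    then show "coeff ([:- a, 1:] ^ M) i * cnj (coeff ([:- a, 1:] ^ Suc M) i)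
        = - cnj a * of_real (real (M choose i) * real (Suc M choose i) * (cmod a ^ 2) ^ (M - i))"
      unfolding coeff_linear_power_binomial i by (simp add: mult_ac del: power_Suc binomial_Suc_Suc)
  qed
  finally show ?thesis
    by (simp only: sum_distrib_left of_real_sum atLeast0LessThan lessThan_Suc_atMost)
qed

text \<open>
  The lower right block with rows \<open>(0, 1)\<close> and \<open>(- a\<^sup>2, 2 a)\<close> has as its own numerical range a disk with
  center \<open>a\<close> and radius \<open>(1 + |a|\<^sup>2) / 2\<close>, contained in that of the whole matrix. A single
  boundary point of it suffices.
\<close>

lemma radius_lower_bound_last_block:
  fixes p :: "complex poly"
  assumes p: "degree p = Suc (Suc N)" "coeff p N = a\<^sup>2" "coeff p (Suc N) = - 2 * a"
    and W: "numerical_range (companion_matrix p) = {z. cmod (z - a) \<le> r}"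
    and "a \<noteq> 0"
  shows "1 + (cmod a)\<^sup>2 \<le> 2 * r"
proof -
  let ?A = "companion_matrix p" and ?n = "Suc (Suc N)"
  let ?B = "\<lambda>i j. companion_matrix p $$ (i, j) - (if i = j then a else 0)"
  have A: "?A \<in> carrier_mat ?n ?n" using companion_matrix_carrier[of p] p(1) by simp
  \<comment> \<open>This phase aligns the two terms of \<open>u - a\<^sup>2 cnj u\<close>, the value of the form.\<close>
  define u where "u = \<i> * a / of_real (cmod a)"
  have u1: "cmod u = 1" using \<open>a \<noteq> 0\<close> by (simp add: u_def norm_divide norm_mult)
  have uu: "u * cnj u = 1" using u1 by (simp add: complex_norm_square[symmetric])
  define x where "x i = (if i = N then 1 else if i = Suc N then u else 0)" for i
  have row: "(\<Sum>j<?n. ?B i j * x j) = (if i = Suc N then - (\<Sum>j<?n. coeff p j * x j) else x (i + 1)) - a * x i"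
    if "i < ?n" for i
    using companion_row[of ?n p i a x] p(1) that by simp
  have "sesq_form ?n ?B x = (u - a) + (- (a\<^sup>2 + (- 2 * a) * u) - a * u) * cnj u"
  proof -
    have "sesq_form ?n ?B x = (\<Sum>i<N. (\<Sum>j<?n. ?B i j * x j) * cnj (x i))
        + (\<Sum>j<?n. ?B N j * x j) * cnj (x N) + (\<Sum>j<?n. ?B (Suc N) j * x j) * cnj (x (Suc N))"
      unfolding sesq_form_def by (simp only: sum.lessThan_Suc[of _ N] sum.lessThan_Suc[of _ "Suc N"])
    also have "(\<Sum>i<N. (\<Sum>j<?n. ?B i j * x j) * cnj (x i)) = 0" by (simp add: x_def)
    also have "(\<Sum>j<?n. ?B N j * x j) * cnj (x N) = u - a" by (subst row) (simp_all add: x_def)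
    also have "(\<Sum>j<?n. ?B (Suc N) j * x j) * cnj (x (Suc N)) = (- (a\<^sup>2 + (- 2 * a) * u) - a * u) * cnj u"
      by (subst row) (simp_all add: x_def p)
    finally show ?thesis by simp
  qed
  also have "\<dots> = u - a\<^sup>2 * cnj u - a * (1 - u * cnj u)" by (simp add: algebra_simps)
  also have "\<dots> = u - a\<^sup>2 * cnj u" by (simp add: uu)
  also have "a\<^sup>2 * cnj u = - (of_real ((cmod a)\<^sup>2) * u)"
    unfolding complex_norm_square u_def by (simp add: power2_eq_square)
  also have "u - - (of_real ((cmod a)\<^sup>2) * u) = of_real (1 + (cmod a)\<^sup>2) * u"
    by (simp add: algebra_simps)
  finally have "cmod (sesq_form ?n ?B x) = 1 + (cmod a)\<^sup>2"
    using u1 by (simp only: norm_mult norm_of_real) simp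
  moreover have "(\<Sum>i<?n. (cmod (x i))\<^sup>2) = 2" by (simp add: x_def u1)
  ultimately show ?thesis using disk_form_bound[OF A W, of x] by simp
qed

text \<open>
  For multiplicity at least three the quotient \<open>s\<close> vanishes at \<open>a\<close>, and the identity would make a
  nonzero number zero. For multiplicity two it determines the radius by
  \<open>(2 r)\<^sup>2 = |a|\<^sup>2 (|a|\<^sup>2 + 2) = (1 + |a|\<^sup>2)\<^sup>2 - 1\<close>, just below the bound from the last block.
\<close>

lemma not_centered_at_nonzero_root:
  fixes a :: complex
  assumes "k \<ge> 1" and "a \<noteq> 0" and "r > 0"
    and p: "p = [:0, 1:] ^ k * [:- a, 1:] ^ Suc (Suc M)"
    and W: "numerical_range (companion_matrix p) = {z. cmod (z - a) \<le> r}"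
  shows False
proof -
  define n where "n = k + Suc (Suc M)"
  define q where "q = [:0, 1:] ^ k * [:- a, 1:] ^ Suc M"
  define s where "s = [:0, 1:] ^ k * [:- a, 1:] ^ M"
  define S where "S = (\<Sum>i\<le>Suc M. real (Suc M choose i) * real (Suc (Suc M) choose i) * (cmod a ^ 2) ^ (Suc M - i))"
  have deg: "degree p = n" unfolding p n_def
    by (subst degree_mult_eq) (simp_all add: degree_power_eq del: power_Suc)
  have lead: "monic p" unfolding p lead_coeff_mult lead_coeff_power by simp
  have pq: "p = [:- a, 1:] * q" unfolding p q_def by (simp only: power_Suc mult_ac)
  have qs: "q = [:- a, 1:] * s" unfolding s_def q_def by (simp only: power_Suc mult_ac)
  have "coeff q 0 = 0" using \<open>k \<ge> 1\<close> unfolding q_def coeff_X_power_mult by simp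
  then have "4 * (of_real r)\<^sup>2 * poly s a = - (a ^ (n - 1)) * (\<Sum>i<n. coeff q i * cnj (coeff p i))"
    using double_root_identity[OF _ deg lead pq qs _ \<open>a \<noteq> 0\<close> W \<open>r > 0\<close>] by (simp add: n_def)
  also have "(\<Sum>i<n. coeff q i * cnj (coeff p i)) = - cnj a * of_real S"
    unfolding p q_def S_def n_def by (rule double_root_sum)
  finally have main: "4 * (of_real r)\<^sup>2 * poly s a = a ^ (n - 1) * cnj a * of_real S" by simp
  have sa: "poly s a = (if M = 0 then a ^ k else 0)" by (simp add: s_def poly_power)
  show False
  proof (cases M)
    case (Suc M')
    have "S > 0" unfolding S_def using \<open>a \<noteq> 0\<close> by (intro sum_pos) (auto simp del: binomial_Suc_Suc)
    then show False using main sa Suc \<open>a \<noteq> 0\<close> by simp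
  next
    case 0
    have n: "n = Suc (Suc k)" by (simp add: n_def 0)
    have "S = (cmod a)\<^sup>2 + 2" by (simp add: S_def 0)
    moreover have "a ^ (n - 1) * cnj a = a ^ k * of_real ((cmod a)\<^sup>2)"
      unfolding complex_norm_square by (simp add: n)
    ultimately have "a ^ k * (4 * (of_real r)\<^sup>2) = a ^ k * of_real ((cmod a)\<^sup>2 * ((cmod a)\<^sup>2 + 2))"
      using main by (simp add: sa 0 mult_ac)
    then have "complex_of_real (4 * r\<^sup>2) = of_real ((cmod a)\<^sup>2 * ((cmod a)\<^sup>2 + 2))"
      using \<open>a \<noteq> 0\<close> by simp
    then have r: "4 * r\<^sup>2 = (cmod a)\<^sup>2 * ((cmod a)\<^sup>2 + 2)" unfolding of_real_eq_iff .
    have "coeff p k = a\<^sup>2" "coeff p (Suc k) = - 2 * a"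
      unfolding p coeff_X_power_mult 0 coeff_linear_power_binomial by (simp_all add: power2_eq_square numeral_2_eq_2)
    then have "1 + (cmod a)\<^sup>2 \<le> 2 * r"
      using deg W \<open>a \<noteq> 0\<close> by (intro radius_lower_bound_last_block[of p k]) (simp_all add: n)
    then have "(1 + (cmod a)\<^sup>2)\<^sup>2 \<le> (2 * r)\<^sup>2" by (intro power_mono) auto
    then show False using r by (simp add: power2_eq_square algebra_simps)
  qed
qed

section \<open>Disks centered at the origin\<close>

text \<open>
  The Chebyshev polynomials of the second kind, by their recursion: up to a factor they are the only
  solutions of \<open>z (i + 1) + z (i - 1) = 2 r z i\<close> with \<open>z (- 1) = 0\<close>.
\<close>

fun chebyshev_U :: "real \<Rightarrow> nat \<Rightarrow> real" where
  "chebyshev_U r 0 = 1"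
| "chebyshev_U r (Suc 0) = 2 * r"
| "chebyshev_U r (Suc (Suc k)) = 2 * r * chebyshev_U r (Suc k) - chebyshev_U r k"

lemma chebyshev_U_no_consecutive_zeros:
  "chebyshev_U r k \<noteq> 0 \<or> chebyshev_U r (Suc k) \<noteq> 0"
  by (induction k) auto

text \<open>
  If \<open>chebyshev_U r (Suc k) = 0\<close>, then the values up to \<open>k\<close> are an eigenvector of the path matrix, and this
  identity computes its Rayleigh quotient as \<open>2 r\<close>.
\<close>

lemma chebyshev_U_rayleigh:
  "2 * r * (\<Sum>i\<le>k. (chebyshev_U r i)\<^sup>2)
    = 2 * (\<Sum>i<k. chebyshev_U r i * chebyshev_U r (Suc i)) + chebyshev_U r k * chebyshev_U r (Suc k)"
  by (induction k) (simp_all add: algebra_simps power2_eq_square)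

text \<open>
  At a zero \<open>Suc k\<close> the vector of the values up to \<open>k\<close> attains the bound \<open>r\<close>. There is still room
  for one more coordinate, and a small entry \<open>e U k\<close> there changes the form at first order in \<open>e\<close> but the
  norm only at second order, which exceeds the bound.
\<close>

lemma chebyshev_U_nonzero:
  assumes "r > 0" and "k < K"
    and form: "\<And>y. (\<Sum>i<K. y i * y (Suc i)) \<le> r * (\<Sum>i\<le>K. (y i)\<^sup>2)"
  shows "chebyshev_U r (Suc k) \<noteq> 0"
proof
  assume zero: "chebyshev_U r (Suc k) = 0"
  define U where "U = chebyshev_U r"
  \<comment> \<open>The inequality to be violated is \<open>e \<le> r e\<^sup>2\<close>; half of \<open>1 / r\<close> is a small enough entry.\<close>
  define e where "e = 1 / (2 * r)"
  define y where "y i = (if i \<le> k then U i else if i = Suc k then e * U k else 0)" for i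
  have "(\<Sum>i<K. y i * y (Suc i)) = (\<Sum>i<Suc k. y i * y (Suc i))"
    using \<open>k < K\<close> by (intro sum.mono_neutral_right) (auto simp: y_def)
  also have "\<dots> = (\<Sum>i<k. U i * U (Suc i)) + e * (U k)\<^sup>2"
    by (simp add: y_def power2_eq_square)
  finally have l: "(\<Sum>i<K. y i * y (Suc i)) = (\<Sum>i<k. U i * U (Suc i)) + e * (U k)\<^sup>2" .
  have "(\<Sum>i\<le>K. (y i)\<^sup>2) = (\<Sum>i\<le>Suc k. (y i)\<^sup>2)"
    using \<open>k < K\<close> by (intro sum.mono_neutral_right) (auto simp: y_def)
  also have "\<dots> = (\<Sum>i\<le>k. (U i)\<^sup>2) + e\<^sup>2 * (U k)\<^sup>2"
    by (simp add: y_def power_mult_distrib)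
  finally have "(\<Sum>i<k. U i * U (Suc i)) + e * (U k)\<^sup>2 \<le> r * ((\<Sum>i\<le>k. (U i)\<^sup>2) + e\<^sup>2 * (U k)\<^sup>2)"
    using form[of y] l by simp
  moreover have "r * (\<Sum>i\<le>k. (U i)\<^sup>2) = (\<Sum>i<k. U i * U (Suc i))"
    using chebyshev_U_rayleigh[of r k] zero by (simp add: U_def)
  ultimately have "e * (U k)\<^sup>2 \<le> r * e\<^sup>2 * (U k)\<^sup>2" by (simp add: algebra_simps)
  moreover have "(U k)\<^sup>2 > 0" using chebyshev_U_no_consecutive_zeros[of r k] zero by (simp add: U_def)
  ultimately have "e \<le> r * e\<^sup>2" by simp
  then show False using \<open>r > 0\<close> by (simp add: e_def power2_eq_square field_simps)
qed

text \<open>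
  For center \<open>0\<close>, conjugating the matrix of the boundary condition at \<open>w\<close> by the diagonal unitary
  with entries \<open>w^i\<close> removes \<open>w\<close> from the shift part: what remains is \<open>2 r\<close> minus the path
  matrix, with the coefficient \<open>p_j\<close> times \<open>w^(j - n)\<close> added to the last row and the conjugate of
  \<open>p_i\<close> times \<open>w^(n - i)\<close> to the last column. The lowest exponent in the last row is \<open>- m\<close>, because
  \<open>p_j\<close> vanishes for \<open>j < n - m\<close>; multiplied by \<open>w^m\<close>, that row becomes polynomial. At \<open>w = 0\<close> only
  \<open>p_(n - m)\<close> is left of it, while the other rows lose their perturbation. The vector \<open>z\<close>
  lies in the kernel of this limit matrix.
\<close>

lemma limit_kernel_vector:
  fixes p :: "complex poly"
  assumes p: "degree p = n" and m: "2 \<le> m" "m < n"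
    and low: "\<And>j. j < n - m \<Longrightarrow> coeff p j = 0" and nz: "coeff p (n - m) \<noteq> 0"
    and W: "numerical_range (companion_matrix p) = {z. cmod z \<le> r}" and "r > 0"
  obtains z :: "nat \<Rightarrow> complex" where "\<exists>i<n. z i \<noteq> 0" and "z (n - m) = 0"
    and "\<forall>i. Suc i < n \<longrightarrow> z (Suc i) = 2 * of_real r * z i - (case i of 0 \<Rightarrow> 0 | Suc k \<Rightarrow> z k)"
proof -
  let ?A = "companion_matrix p"
  have A: "?A \<in> carrier_mat n n" using companion_matrix_carrier[of p] p by simp
  have W0: "numerical_range ?A = {z. cmod (z - 0) \<le> r}" using W by simp
  have n0: "n > 0" using m by simp
  define B where "B = (\<lambda>i j. ?A $$ (i, j) - (if i = j then 0 else (0::complex)))"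
  let ?prev = "\<lambda>(x :: nat \<Rightarrow> complex) i. case i of 0 \<Rightarrow> 0 | Suc k \<Rightarrow> x k"
  \<comment> \<open>\<open>E\<close> is the conjugated matrix without the perturbation of its last row.\<close>
  define E where "E i j = (if i = j then [:2 * complex_of_real r:] else 0)
    - (if i = Suc j then 1 else 0) - (if j = Suc i then 1 else 0)
    + (if j = n - 1 then monom (cnj (coeff p i)) (n - i) else 0)" for i j
  \<comment> \<open>The exponent \<open>m + j - n\<close> is truncated only where \<open>coeff p j = 0\<close>.\<close>
  define D where "D = mat n n (\<lambda>(i, j). if i = n - 1
    then monom 1 m * E i j + monom (coeff p j) (m + j - n) else E i j)"
  have D: "D \<in> carrier_mat n n" by (simp add: D_def)
  have sumE: "(\<Sum>j<n. poly (E i j) w * z j) = 2 * of_real r * z i - ?prev z i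
      - (if Suc i < n then z (Suc i) else 0) + w ^ (n - i) * cnj (coeff p i) * z (n - 1)"
    if "i < n" for i w z
  proof -
    have "(\<Sum>j<n. poly (E i j) w * z j) = (\<Sum>j<n. (if i = j then 2 * of_real r * z j else 0)
      - (if i = Suc j then z j else 0) - (if j = Suc i then z j else 0)
      + (if j = n - 1 then w ^ (n - i) * cnj (coeff p i) * z j else 0))"
      by (intro sum.cong refl) (auto simp: E_def poly_monom algebra_simps)
    also have "(\<dots>) = 2 * of_real r * z i - (\<Sum>j<n. if i = Suc j then z j else 0)
      - (if Suc i < n then z (Suc i) else 0) + w ^ (n - i) * cnj (coeff p i) * z (n - 1)"
      using that by (simp add: sum.distrib sum_subtractf)
    also have "(\<Sum>j<n. if i = Suc j then z j else 0) = ?prev z i"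
      using that by (cases i) auto
    finally show ?thesis .
  qed
  have sumD: "(\<Sum>j<n. poly (D $$ (i, j)) w * z j) = (if i = n - 1
      then w ^ m * (\<Sum>j<n. poly (E i j) w * z j) + (\<Sum>j<n. coeff p j * w ^ (m + j - n) * z j)
      else (\<Sum>j<n. poly (E i j) w * z j))" if "i < n" for i w z
    using that by (simp add: D_def poly_monom algebra_simps sum.distrib sum_distrib_left)
  have "\<exists>z. (\<exists>i<n. z i \<noteq> 0) \<and> (\<forall>i<n. (\<Sum>j<n. poly (D $$ (i, j)) w * z j) = 0)"
    if w: "cmod w = 1" for w
  proof -
    have w0: "w \<noteq> 0" using w by auto
    obtain x where x: "\<exists>i<n. x i \<noteq> 0" and ker: "\<forall>i<n.
        (\<Sum>j<n. ((if i = j then 2 * of_real r * w else 0) - B i j - w\<^sup>2 * cnj (B j i)) * x j) = 0"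
      using disk_boundary_kernel[OF A W0 \<open>r > 0\<close> w B_def] by blast
    \<comment> \<open>The diagonal conjugation, applied to the kernel vector at \<open>w\<close>.\<close>
    define z where "z i = x i / w ^ i" for i
    have xz: "x i = w ^ i * z i" for i using w0 by (simp add: z_def)
    have row: "2 * of_real r * w * x i - (if i = n - 1 then - (\<Sum>j<n. coeff p j * x j) else x (Suc i))
        - w\<^sup>2 * (?prev x i - cnj (coeff p i) * x (n - 1)) = 0" if "i < n" for i
    proof -
      have adj: "(\<Sum>j<n. cnj (B j i) * x j) = ?prev x i - cnj (coeff p i) * x (n - 1)"
      proof -
        have "(\<Sum>j<n. cnj (B j i) * x j) = cnj (\<Sum>j<n. cnj (x j) * B j i)" by (simp add: mult.commute)
        also have "\<dots> = ?prev x i - cnj (coeff p i) * x (n - 1)"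
          unfolding B_def companion_column[OF n0 p that] by (simp split: nat.splits)
        finally show ?thesis .
      qed
      have "0 = (\<Sum>j<n. (if i = j then 2 * of_real r * w * x j else 0) - B i j * x j - w\<^sup>2 * (cnj (B j i) * x j))"
      proof -
        have "0 = (\<Sum>j<n. ((if i = j then 2 * of_real r * w else 0) - B i j - w\<^sup>2 * cnj (B j i)) * x j)"
          using ker that by simp
        also have "\<dots> = (\<Sum>j<n. (if i = j then 2 * of_real r * w * x j else 0) - B i j * x j - w\<^sup>2 * (cnj (B j i) * x j))"
          by (intro sum.cong refl) (simp add: algebra_simps)
        finally show ?thesis .
      qed
      also have "\<dots> = 2 * of_real r * w * x i - (\<Sum>j<n. B i j * x j) - w\<^sup>2 * (\<Sum>j<n. cnj (B j i) * x j)"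
        using that by (simp add: sum_subtractf sum_distrib_left)
      also have "(\<Sum>j<n. B i j * x j) = (if i = n - 1 then - (\<Sum>j<n. coeff p j * x j) else x (Suc i))"
        unfolding B_def companion_row[OF n0 p that] by simp
      finally show ?thesis by (simp only: adj)
    qed
    \<comment> \<open>The factor \<open>w ^ Suc i\<close> undoes the conjugation in row \<open>i\<close> and recovers the original equation.\<close>
    have rowE: "w ^ Suc i * (\<Sum>j<n. poly (E i j) w * z j) = 2 * of_real r * w * x i
        - (if i = n - 1 then 0 else x (Suc i)) - w\<^sup>2 * (?prev x i - cnj (coeff p i) * x (n - 1))"
      if "i < n" for i
    proof -
      have 1: "w ^ Suc i * ?prev z i = w\<^sup>2 * ?prev x i"
        by (cases i) (auto simp: xz power2_eq_square)
      have 2: "w ^ Suc i * (w ^ (n - i) * cnj (coeff p i) * z (n - 1)) = w\<^sup>2 * (cnj (coeff p i) * x (n - 1))"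
      proof -
        have "w ^ Suc i * w ^ (n - i) = w\<^sup>2 * w ^ (n - 1)"
          using that by (simp flip: power_add)
        then show ?thesis by (simp add: xz) (metis mult.assoc mult.commute)
      qed
      have 3: "w ^ Suc i * (if Suc i < n then z (Suc i) else 0) = (if i = n - 1 then 0 else x (Suc i))"
        using that by (auto simp: xz)
      have 4: "w ^ Suc i * (2 * of_real r * z i) = 2 * of_real r * w * x i" by (simp add: xz)
      show ?thesis unfolding sumE[OF that] ring_distribs 1 2 3 4 by simp
    qed
    have "\<exists>i<n. z i \<noteq> 0" using x w0 by (auto simp: z_def)
    moreover have "(\<Sum>j<n. poly (D $$ (i, j)) w * z j) = 0" if "i < n" for i
    proof (cases "i = n - 1")
      case False
      then have "w ^ Suc i * (\<Sum>j<n. poly (E i j) w * z j) = 0"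
        using rowE[OF that] row[OF that] by simp
      then show ?thesis using False w0 by (simp add: sumD[OF that])
    next
      case True
      have "w ^ n * (\<Sum>j<n. coeff p j * w ^ (m + j - n) * z j) = w ^ m * (\<Sum>j<n. coeff p j * x j)"
        unfolding sum_distrib_left
      proof (intro sum.cong refl)
        fix j
        show "w ^ n * (coeff p j * w ^ (m + j - n) * z j) = w ^ m * (coeff p j * x j)"
        proof (cases "j < n - m")
          case False
          then have "w ^ n * w ^ (m + j - n) = w ^ m * w ^ j" using m by (simp flip: power_add)
          then show ?thesis by (simp add: xz)
        qed (simp add: low)
      qed
      moreover have "Suc i = n" using True n0 by simp
      ultimately have "w ^ n * (\<Sum>j<n. poly (D $$ (i, j)) w * z j)
          = w ^ m * (w ^ Suc i * (\<Sum>j<n. poly (E i j) w * z j) + (\<Sum>j<n. coeff p j * x j))"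
        unfolding sumD[OF that] using True by (simp add: algebra_simps)
      also have "w ^ Suc i * (\<Sum>j<n. poly (E i j) w * z j) + (\<Sum>j<n. coeff p j * x j) = 0"
        using row[OF that] unfolding rowE[OF that] if_P[OF True] by (simp add: algebra_simps)
      finally show ?thesis using w0 by simp
    qed
    ultimately show ?thesis by blast
  qed
  then obtain z where z: "\<exists>i<n. z i \<noteq> 0" "\<forall>i<n. (\<Sum>j<n. poly (D $$ (i, j)) 0 * z j) = 0"
    using singular_on_circle_imp_singular_everywhere[OF D, of 0] by blast
  have rec: "z (Suc i) = 2 * of_real r * z i - ?prev z i" if "Suc i < n" for i
  proof -
    have "i < n" "i \<noteq> n - 1" using that by auto
    then show ?thesis
      using z(2)[rule_format, of i] that
      by (simp only: sumD sumE if_False) (simp add: power_0_left algebra_simps)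
  qed
  have last: "z (n - m) = 0"
  proof -
    have "0 = (\<Sum>j<n. coeff p j * 0 ^ (m + j - n) * z j)"
      using z(2)[rule_format, of "n - 1"] n0 m by (simp add: sumD zero_power)
    also have "\<dots> = (\<Sum>j\<in>{n - m}. coeff p j * 0 ^ (m + j - n) * z j)"
    proof (intro sum.mono_neutral_right ballI)
      fix j assume "j \<in> {..<n} - {n - m}"
      then show "coeff p j * 0 ^ (m + j - n) * z j = 0"
        using low[of j] m by (cases "j < n - m") auto
    qed (use m in auto)
    also have "\<dots> = coeff p (n - m) * z (n - m)" using m by simp
    finally show ?thesis using nz by simp
  qed
  show ?thesis using that[of z] z(1) last rec by blast
qed

text \<open>
  Vectors whose last entry is zero do not see the last row: the form is that of the shift of size
  \<open>n - 1\<close>, whatever \<open>p\<close> is.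
\<close>

lemma leading_section_form_bound:
  fixes p :: "complex poly" and y :: "nat \<Rightarrow> real"
  assumes p: "degree p = Suc (Suc N)"
    and W: "numerical_range (companion_matrix p) = {z. cmod z \<le> r}"
  shows "(\<Sum>i<N. y i * y (Suc i)) \<le> r * (\<Sum>i\<le>N. (y i)\<^sup>2)"
proof -
  let ?n = "Suc (Suc N)"
  define B where "B = (\<lambda>i j. companion_matrix p $$ (i, j) - (if i = j then 0 else (0::complex)))"
  have A: "companion_matrix p \<in> carrier_mat ?n ?n" using companion_matrix_carrier[of p] p by simp
  have W0: "numerical_range (companion_matrix p) = {z. cmod (z - 0) \<le> r}" using W by simp
  define x where "x i = (if i \<le> N then complex_of_real (y i) else 0)" for i
  have "sesq_form ?n B x = (\<Sum>i<Suc N. (\<Sum>j<?n. B i j * x j) * cnj (x i))"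
    unfolding sesq_form_def by (intro sum.mono_neutral_right) (auto simp: x_def)
  also have "\<dots> = (\<Sum>i<Suc N. x (Suc i) * cnj (x i))"
  proof (intro sum.cong refl)
    fix i assume "i \<in> {..<Suc N}"
    then show "(\<Sum>j<?n. B i j * x j) * cnj (x i) = x (Suc i) * cnj (x i)"
      using companion_row[of ?n p i 0 x] p unfolding B_def by simp
  qed
  also have "\<dots> = of_real (\<Sum>i<N. y i * y (Suc i))"
    by (simp add: x_def mult.commute)
  finally have form: "sesq_form ?n B x = of_real (\<Sum>i<N. y i * y (Suc i))" .
  have "(\<Sum>i<?n. (cmod (x i))\<^sup>2) = (\<Sum>i\<le>N. (y i)\<^sup>2)"
    by (simp add: x_def flip: lessThan_Suc_atMost)
  then have "\<bar>\<Sum>i<N. y i * y (Suc i)\<bar> \<le> r * (\<Sum>i\<le>N. (y i)\<^sup>2)"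
    using disk_form_bound[OF A W0, of x, folded B_def] unfolding form norm_of_real by simp
  then show ?thesis by simp
qed

text \<open>
  The limit kernel vector is a multiple of the Chebyshev values, so \<open>z (n - m) = 0\<close> says that \<open>r\<close> is
  a zero of the polynomial of index \<open>n - m\<close>. Because \<open>m \<ge> 2\<close>, this index is small enough for the nonvanishing
  result to apply to the leading section of size \<open>n - 1\<close>.
\<close>

lemma not_centered_at_zero:
  fixes p :: "complex poly"
  assumes p: "degree p = n" and m: "2 \<le> m" "m < n"
    and low: "\<And>j. j < n - m \<Longrightarrow> coeff p j = 0" and nz: "coeff p (n - m) \<noteq> 0"
    and W: "numerical_range (companion_matrix p) = {z. cmod z \<le> r}" and "r > 0"
  shows False
proof -
  obtain N where N: "n = Suc (Suc N)" using m by (cases n; cases "n - 1") auto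
  obtain z :: "nat \<Rightarrow> complex" where z: "\<exists>i<n. z i \<noteq> 0" and last: "z (n - m) = 0"
    and rec: "\<forall>i. Suc i < n \<longrightarrow> z (Suc i) = 2 * of_real r * z i - (case i of 0 \<Rightarrow> 0 | Suc k \<Rightarrow> z k)"
    using limit_kernel_vector[OF p m low nz W \<open>r > 0\<close>] by blast
  have "Suc i < n \<Longrightarrow> z i = of_real (chebyshev_U r i) * z 0
      \<and> z (Suc i) = of_real (chebyshev_U r (Suc i)) * z 0" for i
  proof (induction i)
    case 0
    then show ?case using rec[rule_format, of 0] by simp
  next
    case (Suc i)
    then show ?case using rec[rule_format, of "Suc i"] by (simp add: algebra_simps)
  qed
  note zU_step = this
  have zU: "z i = of_real (chebyshev_U r i) * z 0" if "i < n" for i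
  proof (cases i)
    case (Suc k)
    then show ?thesis using zU_step[of k] that by simp
  qed simp
  obtain i where i: "i < n" "z i \<noteq> 0" using z by blast
  then have "z 0 \<noteq> 0" using zU[OF i(1)] by auto
  then have U: "chebyshev_U r (n - m) = 0" using zU[of "n - m"] last m by simp
  have "chebyshev_U r (Suc (n - m - 1)) \<noteq> 0"
    using m by (intro chebyshev_U_nonzero[OF \<open>r > 0\<close> _ leading_section_form_bound[OF p[unfolded N] W]])
      (simp add: N)
  moreover have "Suc (n - m - 1) = n - m" using m by simp
  ultimately show False using U by simp
qed

section \<open>Companion matrices whose numerical range is a disk\<close>

theorem theorem5p2:
  fixes n m :: nat and a :: complex and A :: "complex mat"
  assumes "n > 3" and "2 \<le> m" and "m \<le> n - 1"
    and "A = companion_matrix ([:0, 1:] ^ (n - m) * [:- a, 1:] ^ m)"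
    and "is_circular_disk (numerical_range A)"
  shows "a = 0"
proof (rule ccontr)
  assume a: "a \<noteq> 0"
  define k where "k = n - m"
  obtain M where M: "m = Suc (Suc M)" using \<open>2 \<le> m\<close> by (metis add_2_eq_Suc le_Suc_ex)
  define p where "p = [:0, 1:] ^ k * [:- a, 1:] ^ m"
  have k: "1 \<le> k" "k + m = n" using assms(1-3) by (auto simp: k_def)
  have deg: "degree p = n" unfolding p_def
    by (subst degree_mult_eq) (simp_all add: degree_power_eq k)
  have lead: "monic p" unfolding p_def lead_coeff_mult lead_coeff_power by simp
  obtain c r where "r > 0" and W: "numerical_range (companion_matrix p) = {z. cmod (z - c) \<le> r}"
    using assms(4,5) unfolding is_circular_disk_def p_def k_def by blast
  have "poly p c = 0" using disk_center_is_root[OF _ deg lead W \<open>r > 0\<close>] assms(1) by simp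
  then have "c = 0 \<or> c = a" by (auto simp: p_def poly_power)
  then show False
  proof
    assume "c = 0"
    have "coeff p j = 0" if "j < n - m" for j using that by (simp add: p_def k_def coeff_X_power_mult)
    moreover have "coeff p (n - m) \<noteq> 0"
      using a by (simp add: p_def k_def coeff_X_power_mult coeff_linear_power_binomial)
    ultimately show False
      using not_centered_at_zero[OF deg \<open>2 \<le> m\<close> _ _ _ _ \<open>r > 0\<close>] W \<open>c = 0\<close> k by simp
  next
    assume "c = a"
    then show False
      using not_centered_at_nonzero_root[OF k(1) a \<open>r > 0\<close>, of p M] W by (simp add: p_def M)
  qed
qed

end
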